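(* Let $\mathcal{M}$ be a chromatic moment functional and let $f\in\mathbf{L}^2_{\mathcal{M}}$. Then for all $u\in\mathbb{R}$ and every real $c$ with $0<c<\frac{1}{2\rho}$, the chromatic expansion $$\sum_{k=0}^{\infty}(-1)^k\,\mathcal{K}^k[f](u)\,\mathcal{K}^k[\mathbf{m}](z-u)$$ of $f$ centred at $u$ converges to $f(z)$ uniformly for $z$ in the strip $\mathbb{S}(c)$.
   Context: $\mathcal{M}$ is a linear functional on polynomials with real coefficients in $\omega$, with moments $\mu_n=\mathcal{M}(\omega^n)$; it is positive definite (all Hankel determinants $\det(\mu_{i+j})_{i,j=0}^n$ are $>0$) and normalised ($\mu_0=1$). $\alpha$ is a corresponding moment distribution function: non-decreasing, bounded, taking infinitely many values, with $\mu_n=\int_{-\infty}^{\infty}\omega^n\,d\alpha(\omega)$ for all $n$. $\mathcal{M}$ (and $\alpha$) is chromatic if $\rho:=\limsup_{n\to\infty}\left(\frac{\mu_{2n}}{(2n)!}\right)^{1/(2n)}<\infty$. Convention: $1/0=\infty$. For $0<c\le\infty$, $\mathbb{S}(c)=\{z\in\mathbb{C}:|\mathrm{Im}\,z|<c\}$. $(p_n)_{n\in\mathbb{N}}$ are the orthonormal polynomials of $\mathcal{M}$: $\deg p_n=n$, positive leading coefficient, $\mathcal{M}(p_np_m)=\delta(m-n)$. Chromatic derivatives: $\mathcal{K}^n=\mathrm{i}^n p_n(-\mathrm{i}\,D)$, where $D=d/dz$ (i.e. $\omega^k$ is replaced by $(-\mathrm{i})^kD^k$). $\mathbf{m}(z)=\int_{-\infty}^{\infty}e^{\mathrm{i}\omega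 z}\,d\alpha(\omega)$, analytic on $\mathbb{S}(1/\rho)$. $\mathbf{L}^2_{\mathcal{M}}$ is the vector space of functions $f:\mathbb{S}(\frac{1}{2\rho})\to\mathbb{C}$ analytic on $\mathbb{S}(\frac{1}{2\rho})$ with $\sum_{n=0}^{\infty}|\mathcal{K}^n[f](0)|^2<\infty$. *)

theory Defs
  imports
    "HOL-Complex_Analysis.Complex_Analysis"
    "HOL-Computational_Algebra.Polynomial"
    "Jordan_Normal_Form.Determinant"
begin

definition moment :: "(real poly \<Rightarrow> real) \<Rightarrow> nat \<Rightarrow> real" where
  "moment M n = M (monom 1 n)"

definition hankel_det :: "(real poly \<Rightarrow> real) \<Rightarrow> nat \<Rightarrow> real" where
  "hankel_det M n =
     Determinant.det (Matrix.mat (Suc n) (Suc n) (\<lambda>(i, j). moment M (i + j)))"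

definition moment_functional :: "(real poly \<Rightarrow> real) \<Rightarrow> bool" where
  "moment_functional M \<longleftrightarrow>
     Vector_Spaces.linear Polynomial.smult (*) M \<and> (\<forall>n. hankel_det M n > 0) \<and> moment M 0 = 1"

text \<open>A non-decreasing function need not be right-continuous, whereas
  \<^const>\<open>interval_measure\<close> is only meaningful for right-continuous functions.  Passing to right
  limits changes the function at most at its (countably many) jumps and does not affect the
  Stieltjes integral over the real line.\<close>

definition stieltjes_measure :: "(real \<Rightarrow> real) \<Rightarrow> real measure" where
  "stieltjes_measure \<alpha> = interval_measure (\<lambda>x. Lim (at_right x) \<alpha>)"

definition moment_distribution :: "(real poly \<Rightarrow> real) \<Rightarrow> (real \<Rightarrow> real) \<Rightarrow> bool" where
  "moment_distribution M \<alpha> \<longleftrightarrow>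
     mono \<alpha> \<and> bounded (range \<alpha>) \<and> infinite (range \<alpha>) \<and>
     (\<forall>n. has_bochner_integral (stieltjes_measure \<alpha>) (\<lambda>\<omega>. \<omega> ^ n) (moment M n))"

text \<open>The term at \<open>n = 0\<close> has exponent \<open>1 / 0 = 0\<close> and is irrelevant to the upper limit.\<close>

definition chromatic_rho :: "(real poly \<Rightarrow> real) \<Rightarrow> ereal" where
  "chromatic_rho M =
     limsup (\<lambda>n. ereal ((moment M (2 * n) / fact (2 * n)) powr (1 / real (2 * n))))"

definition chromatic :: "(real poly \<Rightarrow> real) \<Rightarrow> bool" where
  "chromatic M \<longleftrightarrow> moment_functional M \<and> chromatic_rho M < \<infinity>"

definition orthonormal_polys :: "(real poly \<Rightarrow> real) \<Rightarrow> (nat \<Rightarrow> real poly) \<Rightarrow> bool" where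
  "orthonormal_polys M p \<longleftrightarrow>
     (\<forall>n. degree (p n) = n \<and> lead_coeff (p n) > 0) \<and>
     (\<forall>m n. M (p n * p m) = (if m = n then 1 else 0))"

text \<open>With \<open>c = 1 / 0 = \<infinity>\<close> in \<^typ>\<open>ereal\<close> the strip is the whole complex plane.\<close>

definition strip :: "ereal \<Rightarrow> complex set" where
  "strip c = {z. ereal \<bar>Im z\<bar> < c}"

text \<open>The operator \<open>\<i>\<^sup>n p\<^sub>n(-\<i> D)\<close>, for an arbitrary sequence \<open>p\<close> of real polynomials.\<close>

definition chromatic_deriv ::
    "(nat \<Rightarrow> real poly) \<Rightarrow> nat \<Rightarrow> (complex \<Rightarrow> complex) \<Rightarrow> complex \<Rightarrow> complex" where
  "chromatic_deriv p n f z =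
     \<i> ^ n * (\<Sum>k\<le>degree (p n). complex_of_real (coeff (p n) k) * (- \<i>) ^ k * (deriv ^^ k) f z)"

text \<open>Only the values on the strip of half-width \<open>1 / \<rho>\<close> matter; where the integrand is not
  integrable the Bochner integral is 0 by convention.\<close>

definition moment_transform :: "(real \<Rightarrow> real) \<Rightarrow> complex \<Rightarrow> complex" where
  "moment_transform \<alpha> z =
     (LINT \<omega>|stieltjes_measure \<alpha>. exp (\<i> * complex_of_real \<omega> * z))"

text \<open>Members are total functions on the complex numbers; their values outside the strip of
  half-width \<open>1 / (2\<rho>)\<close> are irrelevant.\<close>

definition L2_space ::
    "(real poly \<Rightarrow> real) \<Rightarrow> (nat \<Rightarrow> real poly) \<Rightarrow> (complex \<Rightarrow> complex) set" where
  "L2_space M p =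
     {f. f analytic_on strip (1 / (2 * chromatic_rho M)) \<and>
         summable (\<lambda>n. (cmod (chromatic_deriv p n f 0))\<^sup>2)}"

end

theory Submission
  imports Defs
begin

text \<open>Write \<open>\<mu>\<close> for the Stieltjes measure of \<open>\<alpha>\<close> and \<open>K\<^sub>n\<close> for the \<open>n\<close>-th chromatic derivative.
  Because \<open>2 * c * \<rho> < 1\<close>, the function \<open>exp (2 * c * \<bar>x\<bar>)\<close> is \<open>\<mu>\<close>-integrable
  (\<open>exponential_integrable\<close>).  On the strip of half-width \<open>c\<close> the kernel \<open>exp (\<i> * x * z)\<close> is
  therefore square-integrable, with norm bounded uniformly in \<open>z\<close>.  Since \<open>K\<^sub>n\<close> turns the transform
  of a density \<open>q\<close> into \<open>\<i>\<^sup>n\<close> times the transform of \<open>p\<^sub>n * q\<close> (\<open>chromatic_deriv_transform\<close>), the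
  values \<open>K\<^sub>n[m](z)\<close> are, up to powers of \<open>\<i>\<close>, the Fourier coefficients of the kernel with
  respect to the orthonormal polynomials.  Bessel's inequality bounds their squared sum uniformly on
  the strip.

  For the expansion centred at 0, the Cauchy-Schwarz inequality then shows that the series with any
  square-summable coefficients converges uniformly on the strip.  Its sum is holomorphic, and by
  orthonormality it has the prescribed chromatic derivatives at 0.  These determine all ordinary
  derivatives at 0, so the sum is \<open>f\<close> (\<open>uniform_limit_symbol\<close>).

  For another centre \<open>u\<close> it suffices that the values \<open>K\<^sub>n[f](u)\<close> are again square-summable, because
  then the translate of \<open>f\<close> by \<open>u\<close> satisfies the hypotheses of the case of centre 0.  This is again
  Bessel's inequality, applied to the densities of the partial sums multiplied by the unimodular
  factor \<open>exp (\<i> * u * x)\<close> (\<open>summable_chromatic_deriv\<close>).\<close>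


section \<open>Bessel's inequality in a space of square-integrable functions\<close>

lemma integrable_mult_cnj:
  fixes g h :: "'a \<Rightarrow> complex"
  assumes [measurable]: "g \<in> borel_measurable M" "h \<in> borel_measurable M"
    and "integrable M (\<lambda>x. (cmod (g x))\<^sup>2)" "integrable M (\<lambda>x. (cmod (h x))\<^sup>2)"
  shows "integrable M (\<lambda>x. g x * cnj (h x))"
proof (rule Bochner_Integration.integrable_bound)
  show "integrable M (\<lambda>x. (cmod (g x))\<^sup>2 + (cmod (h x))\<^sup>2)"
    using assms by simp
  have "a * b \<le> a\<^sup>2 + b\<^sup>2" if "0 \<le> a" "0 \<le> b" for a b :: real
    using sum_squares_bound[of a b] mult_nonneg_nonneg[OF that] by linarith
  then show "AE x in M. norm (g x * cnj (h x)) \<le> norm ((cmod (g x))\<^sup>2 + (cmod (h x))\<^sup>2)"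
    by (simp add: norm_mult)
  show "(\<lambda>x. g x * cnj (h x)) \<in> borel_measurable M"
    unfolding borel_measurable_complex_iff by simp
qed

locale orthonormal_functions =
  fixes \<mu> :: "'a measure" and e :: "nat \<Rightarrow> 'a \<Rightarrow> complex"
  assumes measurable_e [measurable]: "e k \<in> borel_measurable \<mu>"
    and square_integrable_e: "integrable \<mu> (\<lambda>x. (cmod (e k x))\<^sup>2)"
    and orthonormal: "(LINT x|\<mu>. e j x * cnj (e k x)) = (if j = k then 1 else 0)"
begin

text \<open>Parseval's identity for finite combinations, with the squared modulus written as \<open>z * cnj z\<close>
  so that it multiplies out by orthonormality.\<close>
lemma has_integral_norm_sum:
  "has_bochner_integral \<mu> (\<lambda>x. (\<Sum>j<K. b j * e j x) * cnj (\<Sum>j<K. b j * e j x))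
     (complex_of_real (\<Sum>j<K. (cmod (b j))\<^sup>2))"
proof -
  have "has_bochner_integral \<mu> (\<lambda>x. e j x * cnj (e k x)) (if j = k then 1 else 0)" for j k
    using integrable_mult_cnj[OF measurable_e measurable_e square_integrable_e square_integrable_e]
      orthonormal by (simp add: has_bochner_integral_iff)
  then have "has_bochner_integral \<mu>
      (\<lambda>x. \<Sum>j<K. \<Sum>k<K. b j * cnj (b k) * (e j x * cnj (e k x)))
      (\<Sum>j<K. \<Sum>k<K. b j * cnj (b k) * (if j = k then 1 else 0))"
    by (intro has_bochner_integral_sum has_bochner_integral_mult_right) auto
  moreover have "(\<Sum>j<K. \<Sum>k<K. b j * cnj (b k) * (if j = k then 1 else 0))
      = complex_of_real (\<Sum>j<K. (cmod (b j))\<^sup>2)"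
    by (simp add: if_distrib[of "\<lambda>x. _ * x"] complex_norm_square flip: of_real_power cong: if_cong)
  ultimately show ?thesis
    by (simp add: sum_product mult_ac)
qed

text \<open>The squared distance of \<open>g\<close> to its projection \<open>s\<close> onto the span of the first \<open>K\<close> functions
  is nonnegative, and expanding it leaves the squared norm of \<open>g\<close> minus the squared norm of
  \<open>s\<close>.\<close>
lemma bessel_inequality:
  assumes [measurable]: "g \<in> borel_measurable \<mu>" and g2: "integrable \<mu> (\<lambda>x. (cmod (g x))\<^sup>2)"
  shows "(\<Sum>k<K. (cmod (LINT x|\<mu>. g x * cnj (e k x)))\<^sup>2) \<le> (LINT x|\<mu>. (cmod (g x))\<^sup>2)"
proof -
  define b where "b k = (LINT x|\<mu>. g x * cnj (e k x))" for k
  define s where "s x = (\<Sum>j<K. b j * e j x)" for x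
  let ?S = "\<Sum>j<K. (cmod (b j))\<^sup>2" and ?G = "LINT x|\<mu>. (cmod (g x))\<^sup>2"
  have "has_bochner_integral \<mu> (\<lambda>x. g x * cnj (e k x)) (b k)" for k
    using integrable_mult_cnj[OF _ measurable_e g2 square_integrable_e]
    by (simp add: has_bochner_integral_iff b_def)
  then have "has_bochner_integral \<mu> (\<lambda>x. \<Sum>k<K. cnj (b k) * (g x * cnj (e k x))) (\<Sum>k<K. cnj (b k) * b k)"
    by (intro has_bochner_integral_sum has_bochner_integral_mult_right) auto
  then have gs: "has_bochner_integral \<mu> (\<lambda>x. g x * cnj (s x)) (complex_of_real ?S)"
    by (simp add: s_def sum_distrib_left complex_norm_square mult_ac del: of_real_power)
  have "has_bochner_integral \<mu> (\<lambda>x. cnj (g x * cnj (s x))) (cnj (complex_of_real ?S))"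
    by (rule has_bochner_integral_bounded_linear[OF bounded_linear_cnj gs])
  then have sg: "has_bochner_integral \<mu> (\<lambda>x. s x * cnj (g x)) (complex_of_real ?S)"
    by (simp add: mult.commute)
  have "has_bochner_integral \<mu> (\<lambda>x. complex_of_real ((cmod (g x))\<^sup>2)) (complex_of_real ?G)"
    using g2 by (intro has_bochner_integral_of_real) (simp add: has_bochner_integral_iff)
  then have gg: "has_bochner_integral \<mu> (\<lambda>x. g x * cnj (g x)) (complex_of_real ?G)"
    by (simp only: complex_norm_square)
  have "has_bochner_integral \<mu>
      (\<lambda>x. g x * cnj (g x) - g x * cnj (s x) - s x * cnj (g x) + s x * cnj (s x))
      (complex_of_real ?G - complex_of_real ?S - complex_of_real ?S + complex_of_real ?S)"
    using has_integral_norm_sum[of b K, folded s_def]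
    by (intro has_bochner_integral_add has_bochner_integral_diff gg gs sg)
  also have "(\<lambda>x. g x * cnj (g x) - g x * cnj (s x) - s x * cnj (g x) + s x * cnj (s x))
      = (\<lambda>x. complex_of_real ((cmod (g x - s x))\<^sup>2))"
    by (simp only: complex_norm_square complex_cnj_diff) (simp add: algebra_simps)
  finally have "has_bochner_integral \<mu> (\<lambda>x. Re (complex_of_real ((cmod (g x - s x))\<^sup>2))) (Re (complex_of_real ?G - complex_of_real ?S))"
    by (intro has_bochner_integral_bounded_linear[OF bounded_linear_Re]) simp
  then have "(LINT x|\<mu>. (cmod (g x - s x))\<^sup>2) = ?G - ?S"
    by (simp add: has_bochner_integral_iff)
  moreover have "0 \<le> (LINT x|\<mu>. (cmod (g x - s x))\<^sup>2)"
    by simp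
  ultimately show ?thesis
    by (simp add: b_def)
qed

end

section \<open>Strips and chromatic derivatives\<close>

lemma strip_real: "strip (ereal c) = {z. \<bar>Im z\<bar> < c}"
  by (simp add: strip_def)

lemma strip_mono: "a \<le> b \<Longrightarrow> strip a \<subseteq> strip b"
  by (auto simp: strip_def intro: less_le_trans)

lemma open_strip: "open (strip (ereal c))"
  unfolding strip_real by (intro open_Collect_less continuous_intros)

lemma connected_strip: "connected (strip (ereal c))"
proof -
  have "strip (ereal c) = {z. Im z < c} \<inter> {z. - c < Im z}"
    by (auto simp: strip_real)
  then show ?thesis
    by (simp add: convex_Int convex_halfspace_Im_lt convex_halfspace_Im_gt convex_connected)
qed

lemma chromatic_deriv_shift:
  "chromatic_deriv p n (\<lambda>z. f (z + a)) z = chromatic_deriv p n f (z + a)"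
proof -
  have "(deriv ^^ k) (\<lambda>z. f (z + a)) = (\<lambda>z. (deriv ^^ k) f (z + a))" for k
  proof (induction k)
    case (Suc k)
    have "deriv (\<lambda>z. g (z + a)) x = deriv g (x + a)" for g :: "complex \<Rightarrow> complex" and x
      by (simp add: deriv_def DERIV_shift)
    then show ?case
      by (simp add: Suc)
  qed simp
  then show ?thesis by (simp add: chromatic_deriv_def)
qed

lemma tendsto_chromatic_deriv:
  assumes "uniform_limit S F f sequentially" "\<And>n. F n holomorphic_on S" "open S" "z \<in> S"
  shows "(\<lambda>N. chromatic_deriv p n (F N) z) \<longlonglongrightarrow> chromatic_deriv p n f z"
  unfolding chromatic_deriv_def
  using higher_deriv_complex_uniform_limit[OF assms(1) _ _ assms(3,4)] assms(2)
  by (intro tendsto_intros) auto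

text \<open>The coefficient of the \<open>n\<close>-th derivative in the \<open>n\<close>-th chromatic derivative is nonzero, so
  the triangular system can be solved for the ordinary derivatives one after another.\<close>
lemma higher_deriv_eq_if_chromatic_deriv_eq:
  assumes "\<And>n. degree (p n) = n" "\<And>n. p n \<noteq> 0"
    and eq: "\<And>n. chromatic_deriv p n f z = chromatic_deriv p n g z"
  shows "(deriv ^^ n) f z = (deriv ^^ n) g z"
proof (induction n rule: less_induct)
  case (less n)
  have split: "{..degree (p n)} = insert n {..<n}"
    using assms(1) by auto
  have "(\<Sum>k<n. complex_of_real (coeff (p n) k) * (- \<i>) ^ k * (deriv ^^ k) f z)
      = (\<Sum>k<n. complex_of_real (coeff (p n) k) * (- \<i>) ^ k * (deriv ^^ k) g z)"
    by (intro sum.cong) (simp_all add: less)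
  moreover have "coeff (p n) n \<noteq> 0"
    using assms(1,2)[of n] by (metis leading_coeff_0_iff)
  ultimately show ?case
    using eq[of n] unfolding chromatic_deriv_def split by simp
qed

section \<open>Fourier transforms of polynomial densities\<close>

lemma poly_le_exp:
  fixes q :: "complex poly"
  assumes "0 < \<epsilon>"
  shows "\<exists>C. \<forall>x::real. cmod (poly q (of_real x)) \<le> C * exp (\<epsilon> * \<bar>x\<bar>)"
  using assms
proof (induction q arbitrary: \<epsilon>)
  case 0
  show ?case by (rule exI[of _ 0]) simp
next
  case (pCons a q)
  then obtain C where C: "cmod (poly q (of_real x)) \<le> C * exp (\<epsilon> / 2 * \<bar>x\<bar>)" for x :: real
    using pCons.IH[of "\<epsilon> / 2"] by auto
  have "cmod (poly (pCons a q) (of_real x)) \<le> (cmod a + 2 / \<epsilon> * C) * exp (\<epsilon> * \<bar>x\<bar>)" for x :: real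
  proof -
    have x: "\<bar>x\<bar> \<le> 2 / \<epsilon> * exp (\<epsilon> / 2 * \<bar>x\<bar>)"
      using exp_ge_add_one_self[of "\<epsilon> / 2 * \<bar>x\<bar>"] pCons.prems by (simp add: field_simps)
    have "cmod (poly (pCons a q) (of_real x)) \<le> cmod a + \<bar>x\<bar> * cmod (poly q (of_real x))"
      by (simp add: norm_triangle_le norm_mult)
    also have "\<dots> \<le> cmod a * exp (\<epsilon> * \<bar>x\<bar>)
        + (2 / \<epsilon> * exp (\<epsilon> / 2 * \<bar>x\<bar>)) * (C * exp (\<epsilon> / 2 * \<bar>x\<bar>))"
      using pCons.prems by (intro add_mono mult_mono x C) (auto simp: mult_le_cancel_left1)
    also have "\<dots> = cmod a * exp (\<epsilon> * \<bar>x\<bar>)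
        + 2 / \<epsilon> * C * exp (\<epsilon> / 2 * \<bar>x\<bar> + \<epsilon> / 2 * \<bar>x\<bar>)"
      by (simp only: exp_add mult_ac)
    also have "\<dots> = (cmod a + 2 / \<epsilon> * C) * exp (\<epsilon> * \<bar>x\<bar>)"
      by (simp add: algebra_simps)
    finally show ?thesis .
  qed
  then show ?case by blast
qed

text \<open>The exponent is \<open>2 * c\<close> because the kernel \<open>exp (\<i> * x * z)\<close> has to be square-integrable for
  \<open>\<bar>Im z\<bar> < c\<close>.\<close>
locale exponential_moments =
  fixes \<mu> :: "real measure" and c :: real
  assumes sets_eq [measurable_cong]: "sets \<mu> = sets borel"
    and c_pos: "0 < c"
    and integrable_exp: "integrable \<mu> (\<lambda>x. exp (2 * c * \<bar>x\<bar>))"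
begin

definition transform :: "complex poly \<Rightarrow> complex \<Rightarrow> complex" where
  "transform q z = (LINT x|\<mu>. poly q (complex_of_real x) * exp (\<i> * complex_of_real x * z))"

lemma measurable_poly [measurable]:
  "(\<lambda>x. poly q (complex_of_real x)) \<in> borel_measurable \<mu>"
proof -
  have "(\<lambda>x. poly q (complex_of_real x)) \<in> borel_measurable borel"
    by (intro borel_measurable_continuous_onI continuous_intros)
  then show ?thesis by simp
qed

lemma integrable_poly_exp:
  assumes "t < 2 * c"
  shows "integrable \<mu> (\<lambda>x. cmod (poly q (complex_of_real x)) * exp (t * \<bar>x\<bar>))"
proof -
  obtain C where C: "cmod (poly q (of_real x)) \<le> C * exp ((2 * c - t) * \<bar>x\<bar>)" for x :: real
    using poly_le_exp[of "2 * c - t" q] assms by auto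
  show ?thesis
  proof (rule Bochner_Integration.integrable_bound)
    show "integrable \<mu> (\<lambda>x. C * exp (2 * c * \<bar>x\<bar>))"
      using integrable_exp by simp
    have "cmod (poly q (of_real x)) * exp (t * \<bar>x\<bar>) \<le> C * exp (2 * c * \<bar>x\<bar>)" for x :: real
    proof -
      have "cmod (poly q (of_real x)) * exp (t * \<bar>x\<bar>)
          \<le> C * exp ((2 * c - t) * \<bar>x\<bar>) * exp (t * \<bar>x\<bar>)"
        by (intro mult_right_mono C) auto
      also have "\<dots> = C * exp ((2 * c - t) * \<bar>x\<bar> + t * \<bar>x\<bar>)"
        by (simp only: exp_add mult_ac)
      finally show ?thesis by (simp add: algebra_simps)
    qed
    from order_trans[OF this abs_ge_self]
    show "AE x in \<mu>. norm (cmod (poly q (complex_of_real x)) * exp (t * \<bar>x\<bar>))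
        \<le> norm (C * exp (2 * c * \<bar>x\<bar>))"
      by simp
  qed measurable
qed

lemma norm_kernel_le: "cmod (exp (\<i> * complex_of_real x * z)) \<le> exp (\<bar>Im z\<bar> * \<bar>x\<bar>)"
proof -
  have "- (x * Im z) \<le> \<bar>Im z\<bar> * \<bar>x\<bar>"
    by (metis abs_ge_minus_self abs_mult mult.commute)
  then show ?thesis by simp
qed

lemma integrable_transform:
  assumes "\<bar>Im z\<bar> < 2 * c"
  shows "integrable \<mu> (\<lambda>x. poly q (complex_of_real x) * exp (\<i> * complex_of_real x * z))"
  by (rule Bochner_Integration.integrable_bound[OF integrable_poly_exp[OF assms, of q]])
     (auto simp: norm_mult simp del: norm_exp_eq_Re intro!: mult_left_mono norm_kernel_le)

lemma transform_sum:
  assumes "\<bar>Im z\<bar> < 2 * c"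
  shows "transform (\<Sum>k\<in>A. Polynomial.smult (b k) (q k)) z = (\<Sum>k\<in>A. b k * transform (q k) z)"
proof -
  have "transform (\<Sum>k\<in>A. Polynomial.smult (b k) (q k)) z =
      (LINT x|\<mu>. (\<Sum>k\<in>A. b k * (poly (q k) (complex_of_real x) * exp (\<i> * complex_of_real x * z))))"
    unfolding transform_def by (simp add: poly_sum sum_distrib_right mult.assoc)
  also have "\<dots> = (\<Sum>k\<in>A. b k * transform (q k) z)"
    unfolding transform_def
    by (subst Bochner_Integration.integral_sum)
       (use integrable_transform[OF assms] in \<open>simp_all add: mult.assoc\<close>)
  finally show ?thesis .
qed

text \<open>Differentiation under the integral sign.  The difference quotient of the kernel differs from its
  derivative by at most \<open>\<bar>h\<bar> * x\<^sup>2 * exp ((\<bar>Im z\<bar> + \<delta>) * \<bar>x\<bar>)\<close>, and for small \<open>\<delta>\<close> this still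
  has a finite integral against any polynomial.\<close>
lemma transform_has_derivative:
  assumes z: "\<bar>Im z\<bar> < 2 * c"
  shows "(transform q has_field_derivative transform ([:0, \<i>:] * q) z) (at z)"
proof -
  define \<delta> where "\<delta> = (2 * c - \<bar>Im z\<bar>) / 2"
  have \<delta>: "0 < \<delta>" "\<bar>Im z\<bar> + \<delta> < 2 * c"
    using z unfolding \<delta>_def by (auto simp: field_simps)
  define w where "w x = cmod (poly ([:0, 0, 1:] * q) (complex_of_real x)) * exp ((\<bar>Im z\<bar> + \<delta>) * \<bar>x\<bar>)" for x
  have int_w: "integrable \<mu> w"
    unfolding w_def by (rule integrable_poly_exp[OF \<delta>(2)])
  have main: "cmod ((transform q (z + h) - transform q z) / h - transform ([:0, \<i>:] * q) z)
      \<le> cmod h * integral\<^sup>L \<mu> w" if h: "h \<noteq> 0" "cmod h < \<delta>" for h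
  proof -
    have zh: "\<bar>Im (z + h)\<bar> < 2 * c"
      using h \<delta> abs_Im_le_cmod[of h] by simp
    let ?d = "\<lambda>x. (poly q (complex_of_real x) * exp (\<i> * complex_of_real x * (z + h))
        - poly q (complex_of_real x) * exp (\<i> * complex_of_real x * z)) / h
        - poly ([:0, \<i>:] * q) (complex_of_real x) * exp (\<i> * complex_of_real x * z)"
    have int: "integrable \<mu> ?d"
      by (intro Bochner_Integration.integrable_diff integrable_divide integrable_transform z zh)
    have le: "cmod (?d x) \<le> cmod h * w x" for x
    proof -
      let ?y = "\<i> * complex_of_real x * h"
      have "?d x = poly q (complex_of_real x) * exp (\<i> * complex_of_real x * z) * (exp ?y - (1 + ?y)) / h"
        using h by (simp add: field_simps flip: exp_add)
      then have "cmod (?d x) = cmod (poly q (complex_of_real x)) *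
          cmod (exp (\<i> * complex_of_real x * z)) * cmod (exp ?y - (1 + ?y)) / cmod h"
        by (simp add: norm_mult norm_divide)
      also have "\<dots> \<le> cmod (poly q (complex_of_real x)) * exp (\<bar>Im z\<bar> * \<bar>x\<bar>)
          * (exp (\<delta> * \<bar>x\<bar>) * (\<bar>x\<bar> * cmod h)\<^sup>2) / cmod h"
      proof (intro divide_right_mono mult_mono norm_kernel_le)
        have "cmod (exp ?y - (1 + ?y)) \<le> exp (cmod ?y) * (cmod ?y)\<^sup>2"
          using Taylor_exp_field[of ?y 1] by (simp add: power2_eq_square)
        also have "\<dots> \<le> exp (\<delta> * \<bar>x\<bar>) * (\<bar>x\<bar> * cmod h)\<^sup>2"
          using h mult_left_mono[of "cmod h" \<delta> "\<bar>x\<bar>"]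
          by (intro mult_mono) (auto simp: norm_mult mult.commute[of \<delta>])
        finally show "cmod (exp ?y - (1 + ?y)) \<le> exp (\<delta> * \<bar>x\<bar>) * (\<bar>x\<bar> * cmod h)\<^sup>2" .
      qed auto
      also have "\<dots> = cmod h * w x"
        using h by (simp add: w_def norm_mult exp_add distrib_right power2_eq_square)
      finally show ?thesis .
    qed
    have "(transform q (z + h) - transform q z) / h - transform ([:0, \<i>:] * q) z = (LINT x|\<mu>. ?d x)"
      unfolding transform_def using z zh
      by (simp add: integrable_transform del: mult_pCons_left poly_mult)
    also have "cmod \<dots> \<le> (LINT x|\<mu>. cmod h * w x)"
      using int int_w le by (intro order_trans[OF integral_norm_bound] integral_mono) auto
    finally show ?thesis by simp
  qed
  have "((\<lambda>h. (transform q (z + h) - transform q z) / h - transform ([:0, \<i>:] * q) z) \<longlongrightarrow> 0) (at 0)"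
  proof (rule Lim_null_comparison)
    show "\<forall>\<^sub>F h in at 0. cmod ((transform q (z + h) - transform q z) / h - transform ([:0, \<i>:] * q) z)
        \<le> cmod h * integral\<^sup>L \<mu> w"
      using \<delta>(1) main unfolding eventually_at by (auto intro!: exI[of _ \<delta>])
    show "((\<lambda>h. cmod h * integral\<^sup>L \<mu> w) \<longlongrightarrow> 0) (at 0)"
      by (auto intro!: tendsto_eq_intros)
  qed
  then show ?thesis
    unfolding DERIV_def by (rule Lim_null[THEN iffD2])
qed

lemma higher_deriv_transform:
  assumes "\<bar>Im z\<bar> < 2 * c"
  shows "(deriv ^^ k) (transform q) z = transform ([:0, \<i>:] ^ k * q) z"
  using assms
proof (induction k arbitrary: z)
  case (Suc k)
  have "\<forall>\<^sub>F y in nhds z. (deriv ^^ k) (transform q) y = transform ([:0, \<i>:] ^ k * q) y"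
    using Suc eventually_nhds_in_open[OF open_strip, of z "2 * c"]
    by (auto simp: strip_real elim!: eventually_mono)
  then have "(deriv ^^ Suc k) (transform q) z = deriv (transform ([:0, \<i>:] ^ k * q)) z"
    by (simp add: deriv_cong_ev)
  also have "\<dots> = transform ([:0, \<i>:] * ([:0, \<i>:] ^ k * q)) z"
    by (rule DERIV_imp_deriv[OF transform_has_derivative[OF Suc.prems]])
  finally show ?case by (simp only: power_Suc mult.assoc)
qed simp

lemma holomorphic_transform: "transform q holomorphic_on strip (ereal c)"
proof (intro holomorphic_onI)
  fix z assume "z \<in> strip (ereal c)"
  then have "\<bar>Im z\<bar> < 2 * c"
    using c_pos by (simp add: strip_real)
  then show "transform q field_differentiable at z within strip (ereal c)"
    using transform_has_derivative field_differentiable_at_within field_differentiable_def by blast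
qed

text \<open>The operator \<open>- \<i> * D\<close> multiplies the density by \<open>x\<close>, so that \<open>p\<^sub>n(- \<i> * D)\<close> multiplies it by
  \<open>p\<^sub>n\<close>.\<close>
lemma chromatic_deriv_transform:
  assumes z: "\<bar>Im z\<bar> < 2 * c"
  shows "chromatic_deriv p n (transform q) z
    = \<i> ^ n * transform (map_poly complex_of_real (p n) * q) z"
proof -
  have poly_eq: "(\<Sum>k\<le>degree (p n). Polynomial.smult (complex_of_real (coeff (p n) k) * (- \<i>) ^ k)
      ([:0, \<i>:] ^ k * q)) = map_poly complex_of_real (p n) * q" (is "?L = ?R")
  proof (rule poly_eq_poly_eq_iff[THEN iffD1], rule ext)
    fix x
    have key: "x ^ k = (- \<i>) ^ k * (x * \<i>) ^ k" for k
      by (subst power_mult_distrib [symmetric]) (simp add: mult.left_commute[of \<i> x])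
    have "poly ?L x = (\<Sum>k\<le>degree (p n). complex_of_real (coeff (p n) k) * x ^ k * poly q x)"
      unfolding key by (simp add: poly_sum mult.assoc)
    then show "poly ?L x = poly ?R x"
      by (simp add: poly_altdef[of "map_poly _ _"] sum_distrib_right coeff_map_poly degree_map_poly)
  qed
  show ?thesis
    using transform_sum[OF z, of "\<lambda>k. complex_of_real (coeff (p n) k) * (- \<i>) ^ k"
        "\<lambda>k. [:0, \<i>:] ^ k * q" "{..degree (p n)}"]
    by (simp only: chromatic_deriv_def higher_deriv_transform[OF z] poly_eq)
qed

end

section \<open>Chromatic expansions for a measure with exponential moments\<close>

locale orthonormal_exponential_moments = exponential_moments +
  fixes p :: "nat \<Rightarrow> real poly"
  assumes degree_p: "degree (p n) = n"
    and orthonormal_p: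
      "(LINT x|\<mu>. poly (p j) x * poly (p k) x) = (if j = k then 1 else 0)"
begin

definition P :: "nat \<Rightarrow> complex poly" where
  "P n = map_poly complex_of_real (p n)"

lemma poly_P: "poly (P n) (complex_of_real x) = complex_of_real (poly (p n) x)"
  by (simp add: P_def poly_altdef coeff_map_poly degree_map_poly)

lemma square_integrable_kernel:
  assumes "\<bar>Im z\<bar> < c"
  shows "integrable \<mu> (\<lambda>x. (cmod (poly q (complex_of_real x) * exp (\<i> * complex_of_real x * z)))\<^sup>2)"
proof (rule Bochner_Integration.integrable_bound)
  show "integrable \<mu> (\<lambda>x. cmod (poly (q * q) (complex_of_real x)) * exp (2 * \<bar>Im z\<bar> * \<bar>x\<bar>))"
    using assms by (intro integrable_poly_exp) auto
  have "(cmod (poly q (complex_of_real x) * exp (\<i> * complex_of_real x * z)))\<^sup>2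
      \<le> cmod (poly (q * q) (complex_of_real x)) * exp (2 * \<bar>Im z\<bar> * \<bar>x\<bar>)" for x
  proof -
    have "(cmod (poly q (complex_of_real x) * exp (\<i> * complex_of_real x * z)))\<^sup>2
        \<le> (cmod (poly q (complex_of_real x)))\<^sup>2 * (exp (\<bar>Im z\<bar> * \<bar>x\<bar>))\<^sup>2"
      unfolding norm_mult power_mult_distrib
      by (intro mult_left_mono power_mono norm_kernel_le) auto
    also have "\<dots> = cmod (poly (q * q) (complex_of_real x)) * exp (2 * \<bar>Im z\<bar> * \<bar>x\<bar>)"
      by (simp add: norm_mult power2_eq_square mult.assoc flip: exp_add)
    finally show ?thesis .
  qed
  then show "AE x in \<mu>. norm ((cmod (poly q (complex_of_real x) * exp (\<i> * complex_of_real x * z)))\<^sup>2)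
      \<le> norm (cmod (poly (q * q) (complex_of_real x)) * exp (2 * \<bar>Im z\<bar> * \<bar>x\<bar>))"
    by (auto simp del: norm_exp_eq_Re)
qed measurable

sublocale orthonormal_functions \<mu> "\<lambda>k x. poly (P k) (complex_of_real x)"
proof
  show "integrable \<mu> (\<lambda>x. (cmod (poly (P k) (complex_of_real x)))\<^sup>2)" for k
    using square_integrable_kernel[of 0 "P k"] c_pos by simp
  show "(LINT x|\<mu>. poly (P j) (complex_of_real x) * cnj (poly (P k) (complex_of_real x)))
      = (if j = k then 1 else 0)" for j k
  proof -
    have "(LINT x|\<mu>. poly (P j) (complex_of_real x) * cnj (poly (P k) (complex_of_real x)))
        = (LINT x|\<mu>. complex_of_real (poly (p j) x * poly (p k) x))"
      by (simp add: poly_P)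
    also have "\<dots> = complex_of_real (LINT x|\<mu>. poly (p j) x * poly (p k) x)"
      by (rule integral_complex_of_real)
    finally show ?thesis by (simp add: orthonormal_p)
  qed
qed measurable

lemma p_nonzero: "p n \<noteq> 0"
  using orthonormal_p[of n n] by auto

lemma transform_P_mult_0: "transform (P j * P k) 0 = (if j = k then 1 else 0)"
  using orthonormal[of j k] by (simp add: transform_def poly_P)

text \<open>The polynomials \<open>p\<^sub>k\<close> are real on the real line, so \<open>transform (P k * q) z\<close> is the inner product
  of the function \<open>q(x) * exp (\<i> * x * z)\<close> with \<open>p\<^sub>k\<close>.\<close>
lemma bessel_transform:
  assumes "\<bar>Im z\<bar> < c"
  shows "(\<Sum>k<K. (cmod (transform (P k * q) z))\<^sup>2)
    \<le> (LINT x|\<mu>. (cmod (poly q (complex_of_real x) * exp (\<i> * complex_of_real x * z)))\<^sup>2)"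
proof -
  have "transform (P k * q) z
      = (LINT x|\<mu>. poly q (complex_of_real x) * exp (\<i> * complex_of_real x * z)
          * cnj (poly (P k) (complex_of_real x)))" for k
    by (simp add: transform_def poly_P mult_ac)
  then show ?thesis
    using bessel_inequality[OF _ square_integrable_kernel[OF assms], of q K] by simp
qed

text \<open>The bound does not depend on \<open>z\<close>; this is what makes the convergence uniform on the strip.\<close>
lemma bessel_transform_strip:
  assumes "\<bar>Im z\<bar> < c"
  shows "(\<Sum>k<K. (cmod (transform (P k) z))\<^sup>2) \<le> (LINT x|\<mu>. exp (2 * c * \<bar>x\<bar>))"
proof -
  have "(\<Sum>k<K. (cmod (transform (P k) z))\<^sup>2)
      \<le> (LINT x|\<mu>. (cmod (exp (\<i> * complex_of_real x * z)))\<^sup>2)"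
    using bessel_transform[OF assms, where K = K and q = 1] by simp
  also have "\<dots> \<le> (LINT x|\<mu>. exp (2 * c * \<bar>x\<bar>))"
  proof (rule integral_mono[OF _ integrable_exp])
    show "integrable \<mu> (\<lambda>x. (cmod (exp (\<i> * complex_of_real x * z)))\<^sup>2)"
      using square_integrable_kernel[OF assms, of 1] by simp
    show "(cmod (exp (\<i> * complex_of_real x * z)))\<^sup>2 \<le> exp (2 * c * \<bar>x\<bar>)" for x
    proof -
      have "cmod (exp (\<i> * complex_of_real x * z)) \<le> exp (c * \<bar>x\<bar>)"
        using assms by (intro order_trans[OF norm_kernel_le]) (simp add: mult_right_mono)
      then have "(cmod (exp (\<i> * complex_of_real x * z)))\<^sup>2 \<le> (exp (c * \<bar>x\<bar>))\<^sup>2"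
        by (intro power_mono) auto
      also have "\<dots> = exp (2 * c * \<bar>x\<bar>)"
        by (simp add: power2_eq_square mult.assoc flip: exp_add)
      finally show ?thesis .
    qed
  qed
  finally show ?thesis .
qed

text \<open>The density whose transform is the \<open>N\<close>-th partial sum of the chromatic expansion centred at the
  origin of a function with chromatic derivatives \<open>a\<close> there.  The factor \<open>(- \<i>)\<^sup>n\<close> is the product of
  the sign \<open>(- 1)\<^sup>n\<close> of the expansion and the power \<open>\<i>\<^sup>n\<close> in the chromatic derivative.\<close>
definition symbol :: "(nat \<Rightarrow> complex) \<Rightarrow> nat \<Rightarrow> complex poly" where
  "symbol a N = (\<Sum>n<N. Polynomial.smult (a n * (- \<i>) ^ n) (P n))"

lemma chromatic_partial_sum:
  assumes "\<bar>Im z\<bar> < 2 * c"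
  shows "(\<Sum>k<N. (- 1) ^ k * a k * chromatic_deriv p k (transform 1) z) = transform (symbol a N) z"
proof -
  have "(- 1) ^ k * a k * (\<i> ^ k * t) = a k * (- \<i>) ^ k * t" for k t
    unfolding power_minus[of \<i>] by (simp only: mult_ac)
  then show ?thesis
    by (simp only: symbol_def transform_sum[OF assms] chromatic_deriv_transform[OF assms] P_def
        mult_1_right)
qed

text \<open>By the Cauchy-Schwarz inequality the square of a block of the series is at most the
  corresponding block of the series of squared coefficients times the uniform bound from Bessel's
  inequality.\<close>
lemma uniformly_convergent_symbol:
  assumes "summable (\<lambda>n. (cmod (a n))\<^sup>2)"
  shows "uniformly_convergent_on (strip (ereal c)) (\<lambda>N. transform (symbol a N))"
proof (intro Cauchy_uniformly_convergent uniformly_Cauchy_onI')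
  fix \<epsilon> :: real assume \<epsilon>: "0 < \<epsilon>"
  define B where "B = (LINT x|\<mu>. exp (2 * c * \<bar>x\<bar>))"
  have B: "0 \<le> B"
    by (simp add: B_def)
  have "0 < \<epsilon>\<^sup>2 / (B + 1)"
    using \<epsilon> B by simp
  then obtain M where M: "\<And>m n. M \<le> m \<Longrightarrow> norm (\<Sum>k=m..<n. (cmod (a k))\<^sup>2) < \<epsilon>\<^sup>2 / (B + 1)"
    using assms unfolding summable_Cauchy by blast
  have "dist (transform (symbol a m) z) (transform (symbol a n) z) < \<epsilon>"
    if z: "z \<in> strip (ereal c)" and mn: "M \<le> m" "m < n" for z m n
  proof -
    have z': "\<bar>Im z\<bar> < c" "\<bar>Im z\<bar> < 2 * c"
      using z c_pos by (auto simp: strip_real)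
    have split: "{..<n} = {..<m} \<union> {m..<n}" "{..<m} \<inter> {m..<n} = {}"
      using mn by auto
    have "transform (symbol a n) z - transform (symbol a m) z
        = (\<Sum>k=m..<n. a k * (- \<i>) ^ k * transform (P k) z)"
      unfolding symbol_def transform_sum[OF z'(2)] split(1)
      by (subst sum.union_disjoint) (use split in auto)
    then have "dist (transform (symbol a m) z) (transform (symbol a n) z)
        = cmod (\<Sum>k=m..<n. a k * (- \<i>) ^ k * transform (P k) z)"
      by (metis dist_commute dist_norm)
    also have "\<dots> \<le> (\<Sum>k=m..<n. cmod (a k) * cmod (transform (P k) z))"
      by (rule sum_norm_le) (simp add: norm_mult norm_power)
    finally have "(dist (transform (symbol a m) z) (transform (symbol a n) z))\<^sup>2
        \<le> (\<Sum>k=m..<n. cmod (a k) * cmod (transform (P k) z))\<^sup>2"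
      by (intro power_mono) auto
    also have "\<dots> \<le> (\<Sum>k=m..<n. (cmod (a k))\<^sup>2) * (\<Sum>k=m..<n. (cmod (transform (P k) z))\<^sup>2)"
      by (rule Cauchy_Schwarz_ineq_sum)
    also have "\<dots> \<le> (\<Sum>k=m..<n. (cmod (a k))\<^sup>2) * B"
    proof (rule mult_left_mono)
      have "(\<Sum>k=m..<n. (cmod (transform (P k) z))\<^sup>2) \<le> (\<Sum>k<n. (cmod (transform (P k) z))\<^sup>2)"
        by (rule sum_mono2) auto
      also have "\<dots> \<le> B"
        unfolding B_def by (rule bessel_transform_strip[OF z'(1)])
      finally show "(\<Sum>k=m..<n. (cmod (transform (P k) z))\<^sup>2) \<le> B" .
    qed (auto intro: sum_nonneg)
    also have "\<dots> \<le> \<epsilon>\<^sup>2 / (B + 1) * B"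
      using M[OF mn(1), of n] B by (intro mult_right_mono) auto
    also have "\<dots> < \<epsilon>\<^sup>2"
      using \<epsilon> B by (simp add: field_simps)
    finally show ?thesis
      using \<epsilon> by (simp add: power2_less_imp_less)
  qed
  then show "\<exists>M. \<forall>z\<in>strip (ereal c). \<forall>m\<ge>M. \<forall>n>m.
      dist (transform (symbol a m) z) (transform (symbol a n) z) < \<epsilon>"
    by blast
qed

text \<open>At the origin the kernel is 1, so, up to the factors \<open>\<i> ^ k\<close>, the chromatic derivatives of a partial
  sum are inner products of its density with the orthonormal polynomials.\<close>
lemma chromatic_deriv_symbol_0:
  assumes "k < N"
  shows "chromatic_deriv p k (transform (symbol a N)) 0 = a k"
proof -
  have 0: "\<bar>Im 0\<bar> < 2 * c"
    using c_pos by simp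
  have "chromatic_deriv p k (transform (symbol a N)) 0 = \<i> ^ k * transform (P k * symbol a N) 0"
    using chromatic_deriv_transform[OF 0] by (simp add: P_def)
  also have "P k * symbol a N = (\<Sum>n<N. Polynomial.smult (a n * (- \<i>) ^ n) (P k * P n))"
    by (simp add: symbol_def sum_distrib_left)
  also have "transform \<dots> 0 = a k * (- \<i>) ^ k"
    using assms by (simp add: transform_sum[OF 0] transform_P_mult_0 if_distrib[of "\<lambda>x. _ * x"] cong: if_cong)
  also have "\<i> ^ k * (a k * (- \<i>) ^ k) = a k"
    using power_mult_distrib[of \<i> "- \<i>" k] by (simp add: mult_ac)
  finally show ?thesis .
qed

text \<open>The uniform limit \<open>g\<close> of the partial sums is holomorphic and has the same chromatic derivatives
  at the origin as \<open>f\<close>, hence the same Taylor series there; the identity theorem gives \<open>f = g\<close>.\<close>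
lemma uniform_limit_symbol:
  assumes f: "f holomorphic_on strip (ereal c)"
    and summable: "summable (\<lambda>n. (cmod (chromatic_deriv p n f 0))\<^sup>2)"
  shows "uniform_limit (strip (ereal c))
    (\<lambda>N. transform (symbol (\<lambda>n. chromatic_deriv p n f 0) N)) f sequentially"
proof -
  let ?S = "strip (ereal c)"
  define F where "F N = transform (symbol (\<lambda>n. chromatic_deriv p n f 0) N)" for N
  obtain g where lim: "uniform_limit ?S F g sequentially"
    using uniformly_convergent_symbol[OF summable] unfolding uniformly_convergent_on_def F_def by blast
  have holo: "F N holomorphic_on ?S" for N
    unfolding F_def by (rule holomorphic_transform)
  have 0: "0 \<in> ?S"
    using c_pos by (simp add: strip_real)
  have g: "g holomorphic_on ?S"
  proof (rule holomorphic_uniform_sequence[OF open_strip holo])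
    fix z assume "z \<in> ?S"
    then obtain d where "0 < d" "cball z d \<subseteq> ?S"
      using open_strip open_contains_cball by blast
    then show "\<exists>d>0. cball z d \<subseteq> ?S \<and> uniform_limit (cball z d) F g sequentially"
      using uniform_limit_on_subset[OF lim] by blast
  qed
  have "chromatic_deriv p n f 0 = chromatic_deriv p n g 0" for n
  proof (rule LIMSEQ_unique)
    show "(\<lambda>N. chromatic_deriv p n (F N) 0) \<longlonglongrightarrow> chromatic_deriv p n g 0"
      by (rule tendsto_chromatic_deriv[OF lim holo open_strip 0])
    have "\<forall>\<^sub>F N in sequentially. chromatic_deriv p n (F N) 0 = chromatic_deriv p n f 0"
      using eventually_gt_at_top[of n] by eventually_elim (simp add: F_def chromatic_deriv_symbol_0)
    then show "(\<lambda>N. chromatic_deriv p n (F N) 0) \<longlonglongrightarrow> chromatic_deriv p n f 0"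
      by (rule tendsto_eventually)
  qed
  then have "f z = g z" if "z \<in> ?S" for z
    using higher_deriv_eq_if_chromatic_deriv_eq[of p f 0 g] degree_p p_nonzero that
    by (intro holomorphic_fun_eq_on_connected[OF f g open_strip connected_strip _ 0]) auto
  then have "uniform_limit ?S F f sequentially"
    using lim by (subst uniform_limit_cong'[where g = F and i = g]) auto
  then show ?thesis by (simp add: F_def[abs_def])
qed

text \<open>Moving the centre to \<open>u\<close> multiplies densities by \<open>exp (\<i> * u * x)\<close>, which has modulus 1.  So
  Bessel's inequality bounds the chromatic derivatives at \<open>u\<close> of each partial sum by the squared
  norm of its density, which is a partial sum of the series of squared coefficients; the bound
  passes to the limit.\<close>
lemma summable_chromatic_deriv:
  assumes f: "f holomorphic_on strip (ereal c)"
    and summable: "summable (\<lambda>n. (cmod (chromatic_deriv p n f 0))\<^sup>2)"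
  shows "summable (\<lambda>n. (cmod (chromatic_deriv p n f (complex_of_real u)))\<^sup>2)"
proof -
  define a where "a n = chromatic_deriv p n f 0" for n
  have u: "complex_of_real u \<in> strip (ereal c)" "\<bar>Im (complex_of_real u)\<bar> < c"
      "\<bar>Im (complex_of_real u)\<bar> < 2 * c"
    using c_pos by (auto simp: strip_real)
  have bound: "(\<Sum>k<K. (cmod (chromatic_deriv p k (transform (symbol a N)) u))\<^sup>2)
      \<le> (\<Sum>n. (cmod (a n))\<^sup>2)" for K N
  proof -
    have "(\<Sum>k<K. (cmod (chromatic_deriv p k (transform (symbol a N)) u))\<^sup>2)
        = (\<Sum>k<K. (cmod (transform (P k * symbol a N) u))\<^sup>2)"
      by (simp add: chromatic_deriv_transform[OF u(3)] P_def norm_mult norm_power)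
    also have "\<dots> \<le> (LINT x|\<mu>. (cmod (poly (symbol a N) (complex_of_real x)
        * exp (\<i> * complex_of_real x * complex_of_real u)))\<^sup>2)"
      by (rule bessel_transform[OF u(2)])
    also have "\<dots> = (LINT x|\<mu>. (cmod (poly (symbol a N) (complex_of_real x)))\<^sup>2)"
      by (simp add: norm_mult)
    also have "\<dots> = (\<Sum>n<N. (cmod (a n))\<^sup>2)"
    proof -
      have "has_bochner_integral \<mu>
          (\<lambda>x. complex_of_real ((cmod (poly (symbol a N) (complex_of_real x)))\<^sup>2))
          (complex_of_real (\<Sum>n<N. (cmod (a n * (- \<i>) ^ n))\<^sup>2))"
        using has_integral_norm_sum[of "\<lambda>n. a n * (- \<i>) ^ n" N]
        by (simp only: complex_norm_square symbol_def poly_sum poly_smult)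
      then have "complex_of_real (LINT x|\<mu>. (cmod (poly (symbol a N) (complex_of_real x)))\<^sup>2)
          = complex_of_real (\<Sum>n<N. (cmod (a n * (- \<i>) ^ n))\<^sup>2)"
        unfolding has_bochner_integral_iff integral_complex_of_real by blast
      then show ?thesis
        unfolding of_real_eq_iff by (simp add: norm_mult norm_power)
    qed
    also have "\<dots> \<le> (\<Sum>n. (cmod (a n))\<^sup>2)"
      using summable by (intro sum_le_suminf) (auto simp: a_def)
    finally show ?thesis .
  qed
  have "(\<lambda>N. \<Sum>k<K. (cmod (chromatic_deriv p k (transform (symbol a N)) u))\<^sup>2)
      \<longlonglongrightarrow> (\<Sum>k<K. (cmod (chromatic_deriv p k f u))\<^sup>2)" for K
    using uniform_limit_symbol[OF assms, folded a_def] holomorphic_transform open_strip u(1)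
    by (intro tendsto_intros tendsto_chromatic_deriv[where S = "strip (ereal c)"])
  then have "(\<Sum>k<K. (cmod (chromatic_deriv p k f u))\<^sup>2) \<le> (\<Sum>n. (cmod (a n))\<^sup>2)" for K
    by (rule LIMSEQ_le_const2) (use bound in blast)
  then show ?thesis
    by (intro summableI_nonneg_bounded[where x = "\<Sum>n. (cmod (a n))\<^sup>2"]) auto
qed

text \<open>The translate of \<open>f\<close> by \<open>u\<close> has square-summable chromatic derivatives at the origin, so
  its expansion centred at the origin converges to it; translating back gives the expansion centred
  at \<open>u\<close>.\<close>
theorem chromatic_expansion:
  assumes f: "f holomorphic_on strip (ereal c)"
    and summable: "summable (\<lambda>n. (cmod (chromatic_deriv p n f 0))\<^sup>2)"
  shows "uniform_limit (strip (ereal c))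
    (\<lambda>N z. \<Sum>k<N. (- 1) ^ k * chromatic_deriv p k f (complex_of_real u)
        * chromatic_deriv p k (transform 1) (z - complex_of_real u)) f sequentially"
proof -
  let ?S = "strip (ereal c)" and ?g = "\<lambda>z. f (z + complex_of_real u)"
  have "?g holomorphic_on ?S"
    by (intro holomorphic_on_compose_gen[OF _ f, unfolded o_def] holomorphic_intros)
       (auto simp: strip_real)
  moreover have g0: "chromatic_deriv p n ?g 0 = chromatic_deriv p n f (complex_of_real u)" for n
    by (simp add: chromatic_deriv_shift)
  ultimately have lim: "uniform_limit ?S
      (\<lambda>N. transform (symbol (\<lambda>n. chromatic_deriv p n f (complex_of_real u)) N)) ?g sequentially"
    using uniform_limit_symbol[of ?g] summable_chromatic_deriv[OF assms, of u] by simp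
  have "uniform_limit ?S
      (\<lambda>N z. transform (symbol (\<lambda>n. chromatic_deriv p n f (complex_of_real u)) N)
          (z - complex_of_real u)) f sequentially"
  proof (rule uniform_limitI)
    fix \<epsilon> :: real assume "0 < \<epsilon>"
    from uniform_limitD[OF lim this]
    show "\<forall>\<^sub>F N in sequentially. \<forall>z\<in>?S.
        dist (transform (symbol (\<lambda>n. chromatic_deriv p n f (complex_of_real u)) N)
          (z - complex_of_real u)) (f z) < \<epsilon>"
    proof eventually_elim
      case (elim N)
      show ?case
      proof
        fix z assume "z \<in> ?S"
        then have "z - complex_of_real u \<in> ?S"
          by (simp add: strip_real)
        from bspec[OF elim this] show "dist (transform (symbol (\<lambda>n. chromatic_deriv p n f (complex_of_real u)) N)
          (z - complex_of_real u)) (f z) < \<epsilon>" by simp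
      qed
    qed
  qed
  then show ?thesis
  proof (rule uniform_limit_cong'[THEN iffD1, rotated -1])
    fix N z assume "z \<in> ?S"
    then have "\<bar>Im (z - complex_of_real u)\<bar> < 2 * c"
      using c_pos by (simp add: strip_real)
    then show "transform (symbol (\<lambda>n. chromatic_deriv p n f (complex_of_real u)) N) (z - complex_of_real u)
        = (\<Sum>k<N. (- 1) ^ k * chromatic_deriv p k f (complex_of_real u)
        * chromatic_deriv p k (transform 1) (z - complex_of_real u))"
      by (simp add: chromatic_partial_sum)
  qed simp
qed

end

section \<open>Exponential moments of a chromatic functional\<close>

lemma chromatic_rho_nonneg: "0 \<le> chromatic_rho M"
  unfolding chromatic_rho_def by (intro le_Limsup always_eventually) auto

text \<open>Since \<open>2 * c * \<rho> < 1\<close>, the root test shows that integrating the power series of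
  \<open>cosh (2 * c * x)\<close> term by term gives a convergent series of even moments.\<close>
lemma exponential_integrable:
  assumes \<mu>: "\<And>n. has_bochner_integral \<mu> (\<lambda>x::real. x ^ n) (moment M n)"
    and sets: "sets \<mu> = sets borel"
    and c: "0 < c" "ereal c < 1 / (2 * chromatic_rho M)"
    and fin: "chromatic_rho M < \<infinity>"
  shows "integrable \<mu> (\<lambda>x. exp (2 * c * \<bar>x\<bar>))"
proof -
  note [measurable_cong] = sets
  define h where "h n x = (2 * c * x) ^ (2 * n) / fact (2 * n)" for n and x :: real
  define m where "m n = moment M (2 * n) / fact (2 * n)" for n
  have m_nonneg: "0 \<le> m n" for n
  proof -
    have "moment M (2 * n) = (LINT x|\<mu>. x ^ (2 * n))"
      using \<mu> by (simp add: has_bochner_integral_iff)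
    then show ?thesis by (simp add: m_def power_mult)
  qed
  have h_int: "has_bochner_integral \<mu> (h n) ((2 * c) ^ (2 * n) * m n)" for n
    using has_bochner_integral_mult_right[OF \<mu>[of "2 * n"], of "(2 * c) ^ (2 * n) / fact (2 * n)"]
    by (simp add: h_def[abs_def] m_def power_mult_distrib)
  have h_nonneg: "0 \<le> h n x" for n x
    by (simp add: h_def power_mult)
  have h_sums: "(\<lambda>n. h n x) sums cosh (2 * c * x)" for x
  proof -
    have "(\<lambda>n. (\<lambda>n. if even n then (2 * c * x) ^ n /\<^sub>R fact n else 0) (2 * n)) sums cosh (2 * c * x)"
      by (rule sums_mono_reindex[THEN iffD2, OF _ _ cosh_converges]) (auto simp: strict_mono_def elim!: evenE)
    then show ?thesis by (simp add: h_def field_simps)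
  qed
  (* If rho = 0, the width 1 / (2 * rho) is infinite and every c is admissible. *)
  have "chromatic_rho M < ereal (1 / (2 * c))"
  proof (cases "chromatic_rho M")
    case (real r)
    show ?thesis
    proof (cases "r = 0")
      case False
      then have "0 < r"
        using chromatic_rho_nonneg[of M] real by simp
      then show ?thesis
        using c real by (simp add: field_simps divide_ereal_def one_ereal_def)
    qed (use c real in simp)
  qed (use fin chromatic_rho_nonneg[of M] in auto)
  then obtain s where s: "chromatic_rho M < ereal s" "s < 1 / (2 * c)"
    using ereal_dense2 by (metis ereal_less_ereal_Ex less_ereal.simps(1))
  have s_pos: "0 < s"
    using s(1) chromatic_rho_nonneg[of M] by (metis ereal_less(2) le_less_trans)
  have "\<forall>\<^sub>F n in sequentially. ereal (m n powr (1 / real (2 * n))) < ereal s"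
    using Limsup_lessD[OF s(1)[unfolded chromatic_rho_def]] by (simp add: m_def)
  then have "\<forall>\<^sub>F n in sequentially. norm ((2 * c) ^ (2 * n) * m n) \<le> ((2 * c * s)\<^sup>2) ^ n"
    using eventually_gt_at_top[of 0]
  proof eventually_elim
    case (elim n)
    have "m n = (m n powr (1 / real (2 * n))) powr real (2 * n)"
      using elim m_nonneg[of n] by (simp add: powr_powr)
    also have "\<dots> \<le> s powr real (2 * n)"
      using elim by (intro powr_mono2) auto
    also have "\<dots> = s ^ (2 * n)"
      using s_pos by (rule powr_realpow)
    finally have "(2 * c) ^ (2 * n) * m n \<le> (2 * c) ^ (2 * n) * s ^ (2 * n)"
      using c by (intro mult_left_mono) auto
    also have "\<dots> = ((2 * c * s)\<^sup>2) ^ n"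
      by (simp only: power_mult_distrib power_mult)
    finally show ?case
      using m_nonneg[of n] c by (simp add: abs_mult)
  qed
  moreover have "(2 * c * s)\<^sup>2 < 1"
  proof -
    have "2 * c * s < 1"
      using s(2) c(1) by (simp add: field_simps)
    then show ?thesis
      unfolding abs_square_less_1 using s_pos c(1) by simp
  qed
  ultimately have summable: "summable (\<lambda>n. (2 * c) ^ (2 * n) * m n)"
    by (intro summable_comparison_test_ev[OF _ summable_geometric]) auto
  have "integrable \<mu> (\<lambda>x. \<Sum>n. h n x)"
  proof (rule integrable_suminf)
    show "integrable \<mu> (h n)" for n
      using h_int by (simp add: has_bochner_integral_iff)
    show "AE x in \<mu>. summable (\<lambda>n. norm (h n x))"
      using h_sums by (simp add: h_nonneg sums_iff)
    show "summable (\<lambda>n. LINT x|\<mu>. norm (h n x))"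
      using summable h_int by (simp add: h_nonneg has_bochner_integral_iff)
  qed
  then have cosh_int: "integrable \<mu> (\<lambda>x. 2 * cosh (2 * c * x))"
    using h_sums by (simp add: sums_iff)
  show ?thesis
  proof (rule Bochner_Integration.integrable_bound[OF cosh_int])
    have "exp (2 * c * \<bar>x\<bar>) \<le> 2 * cosh (2 * c * x)" for x
      by (cases "0 \<le> x") (auto simp: cosh_def)
    then show "AE x in \<mu>. norm (exp (2 * c * \<bar>x\<bar>)) \<le> norm (2 * cosh (2 * c * x))"
      by (simp add: abs_mult)
  qed measurable
qed

lemma functional_eq_integral:
  assumes "Vector_Spaces.linear Polynomial.smult (*) M"
    and \<mu>: "\<And>n. has_bochner_integral \<mu> (\<lambda>x::real. x ^ n) (moment M n)"
  shows "M q = (LINT x|\<mu>. poly q x)"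
proof -
  interpret M: Vector_Spaces.linear Polynomial.smult "(*)" M by fact
  have "M q = M (\<Sum>k\<le>degree q. Polynomial.smult (coeff q k) (monom 1 k))"
    by (simp add: smult_monom poly_as_sum_of_monoms)
  also have "\<dots> = (\<Sum>k\<le>degree q. coeff q k * moment M k)"
    by (simp add: M.sum M.scale moment_def)
  also have "has_bochner_integral \<mu> (\<lambda>x. \<Sum>k\<le>degree q. coeff q k * x ^ k) \<dots>"
    by (intro has_bochner_integral_sum has_bochner_integral_mult_right \<mu>)
  then have "(\<Sum>k\<le>degree q. coeff q k * moment M k) = (LINT x|\<mu>. poly q x)"
    by (simp add: poly_altdef has_bochner_integral_iff)
  finally show ?thesis .
qed

section \<open>Convergence of the chromatic expansion\<close>

theorem theorem3p1:
  fixes M :: "real poly \<Rightarrow> real"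
    and \<alpha> :: "real \<Rightarrow> real"
    and p :: "nat \<Rightarrow> real poly"
    and f :: "complex \<Rightarrow> complex"
    and u c :: real
  assumes "chromatic M"
    and "moment_distribution M \<alpha>"
    and "orthonormal_polys M p"
    and "f \<in> L2_space M p"
    and "0 < c"
    and "ereal c < 1 / (2 * chromatic_rho M)"
  shows "uniform_limit (strip (ereal c))
           (\<lambda>N z. \<Sum>k<N. (- 1) ^ k * chromatic_deriv p k f (complex_of_real u)
                          * chromatic_deriv p k (moment_transform \<alpha>) (z - complex_of_real u))
           f sequentially"
proof -
  let ?\<mu> = "stieltjes_measure \<alpha>"
  have \<mu>: "has_bochner_integral ?\<mu> (\<lambda>x. x ^ n) (moment M n)" for n
    using assms(2) by (simp add: moment_distribution_def)
  have sets: "sets ?\<mu> = sets borel"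
    by (simp add: stieltjes_measure_def)
  have linear: "Vector_Spaces.linear Polynomial.smult (*) M"
    using assms(1) by (simp add: chromatic_def moment_functional_def)
  interpret orthonormal_exponential_moments ?\<mu> c p
  proof
    show "integrable ?\<mu> (\<lambda>x. exp (2 * c * \<bar>x\<bar>))"
      using assms(1,5,6) by (intro exponential_integrable[OF \<mu> sets]) (auto simp: chromatic_def)
    show "(LINT x|?\<mu>. poly (p j) x * poly (p k) x) = (if j = k then 1 else 0)" for j k
    proof -
      have "M (p j * p k) = (if j = k then 1 else 0)"
        using assms(3) by (simp add: orthonormal_polys_def)
      then show ?thesis
        using functional_eq_integral[OF linear \<mu>, of "p j * p k"] by simp
    qed
    show "degree (p n) = n" for n
      using assms(3) by (simp add: orthonormal_polys_def)
  qed (use sets assms(5) in auto)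
  have "strip (ereal c) \<subseteq> strip (1 / (2 * chromatic_rho M))"
    by (rule strip_mono[OF less_imp_le[OF assms(6)]])
  then have "f holomorphic_on strip (ereal c)"
    using assms(4) analytic_imp_holomorphic holomorphic_on_subset unfolding L2_space_def by blast
  moreover have "moment_transform \<alpha> = transform 1"
    by (simp add: fun_eq_iff moment_transform_def transform_def)
  ultimately show ?thesis
    using chromatic_expansion[of f u] assms(4) by (simp add: L2_space_def)
qed

end
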